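(* Let $(V,b,\psi)$ be a real cosymplectic vector space with Reeb vector $\xi$. (1) For a subspace $F$ of $V$ whose sum with $\langle\xi\rangle$ is direct, $F\oplus\langle\xi\rangle$ is cosymplectically coisotropic and minimal (with respect to inclusion among cosymplectically coisotropic subspaces) if and only if $F$ is Lagrangian-like. (2) Given any finite collection $L_1,\dots,L_k$ of Lagrangian-like subspaces of $V$, there exists a Lagrangian-like subspace $L$ of $V$ with $L\cap L_j=\{0\}$ for all $1\le j\le k$.
   Context: A cosymplectic vector space $(V,b,\psi)$ is a finite-dimensional real vector space $V$ with an antisymmetric bilinear form $b$ and a nonzero linear form $\psi$ such that $\widetilde I_{\psi,b}:V\to V^*$, $\widetilde I_{\psi,b}(v)(u)=b(v,u)+\psi(v)\psi(u)$, is bijective. The Reeb vector $\xi$ is the vector with $\psi(\xi)=1$ and $b(\xi,\cdot)=0$. For $F\subset V$ put $F^{b,\psi}=\{x\in V:\widetilde I_{\psi,b}(x)(y)=0\ \forall y\in F\}$. A proper subspace $F$ is cosymplectically coisotropic if $F^{b,\psi}\subset F$; cosymplectically isotropic if $\widetilde I_{\psi,b}(x)(y)=0$ for all $x,y\in F$; Lagrangian-like (cosymplectically Lagrangian) if it is cosymplectically isotropic, does not contain $\xi$, and $F^{b,\psi}=\langle\xi\rangle\oplus F$.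
   Formalization: Part (1) is proved for dim V > 1 and subspaces F on which ψ vanishes; without these it is false (F = ⟨e1+e3⟩ in R³ with b = dx∧dy, ψ = dz; or F = {0} with dim V = 1). Lagrangian-like subspaces always satisfy ψ = 0. Part (2) is unchanged. *)

theory Defs
  imports "HOL-Analysis.Analysis"
begin

definition finite_dim :: "'a::real_vector itself \<Rightarrow> bool" where
  "finite_dim _ \<longleftrightarrow> (\<exists>B :: 'a set. finite B \<and> span B = UNIV)"

definition cosymp_map :: "('a \<Rightarrow> 'a \<Rightarrow> real) \<Rightarrow> ('a \<Rightarrow> real) \<Rightarrow> 'a::real_vector \<Rightarrow> 'a \<Rightarrow> real" where
  "cosymp_map b \<psi> v u = b v u + \<psi> v * \<psi> u"

text \<open>The whole type plays the role of $V$, and the set of linear functionals that of $V^*$.\<close>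

definition cosymplectic :: "('a::real_vector \<Rightarrow> 'a \<Rightarrow> real) \<Rightarrow> ('a \<Rightarrow> real) \<Rightarrow> bool" where
  "cosymplectic b \<psi> \<longleftrightarrow>
     finite_dim TYPE('a) \<and>
     bilinear b \<and> (\<forall>u v. b u v = - b v u) \<and>
     linear \<psi> \<and> (\<exists>v. \<psi> v \<noteq> 0) \<and>
     bij_betw (cosymp_map b \<psi>) UNIV {f. linear f}"

text \<open>The conditions above also hold for some even-dimensional $V$ (a symplectic \<open>b\<close> and any
  nonzero \<open>\<psi>\<close>), where no Reeb vector exists. So the Reeb vector is a predicate rather than a
  function of \<open>b\<close> and \<open>\<psi>\<close>. It is unique when it exists, since \<open>cosymp_map b \<psi> \<xi> = \<psi>\<close>.\<close>

definition reeb_vector :: "('a::real_vector \<Rightarrow> 'a \<Rightarrow> real) \<Rightarrow> ('a \<Rightarrow> real) \<Rightarrow> 'a \<Rightarrow> bool" where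
  "reeb_vector b \<psi> \<xi> \<longleftrightarrow> \<psi> \<xi> = 1 \<and> (\<forall>u. b \<xi> u = 0)"

text \<open>The form \<open>cosymp_map b \<psi>\<close> is neither symmetric nor antisymmetric; in the complement the
  varying vector is its first argument.\<close>

definition cosymp_compl :: "('a::real_vector \<Rightarrow> 'a \<Rightarrow> real) \<Rightarrow> ('a \<Rightarrow> real) \<Rightarrow> 'a set \<Rightarrow> 'a set" where
  "cosymp_compl b \<psi> F = {x. \<forall>y\<in>F. cosymp_map b \<psi> x y = 0}"

definition cosymp_coisotropic :: "('a::real_vector \<Rightarrow> 'a \<Rightarrow> real) \<Rightarrow> ('a \<Rightarrow> real) \<Rightarrow> 'a set \<Rightarrow> bool" where
  "cosymp_coisotropic b \<psi> F \<longleftrightarrow> subspace F \<and> F \<noteq> UNIV \<and> cosymp_compl b \<psi> F \<subseteq> F"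

definition cosymp_isotropic :: "('a::real_vector \<Rightarrow> 'a \<Rightarrow> real) \<Rightarrow> ('a \<Rightarrow> real) \<Rightarrow> 'a set \<Rightarrow> bool" where
  "cosymp_isotropic b \<psi> F \<longleftrightarrow>
     subspace F \<and> F \<noteq> UNIV \<and> (\<forall>x\<in>F. \<forall>y\<in>F. cosymp_map b \<psi> x y = 0)"

text \<open>Below, \<open>+\<close> is the Minkowski sum of sets. It is automatically a direct sum, because \<open>F\<close> is a
  subspace that does not contain \<open>\<xi>\<close>.\<close>

definition lagrangian_like ::
    "('a::real_vector \<Rightarrow> 'a \<Rightarrow> real) \<Rightarrow> ('a \<Rightarrow> real) \<Rightarrow> 'a \<Rightarrow> 'a set \<Rightarrow> bool" where
  "lagrangian_like b \<psi> \<xi> F \<longleftrightarrow>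
     cosymp_isotropic b \<psi> F \<and> \<xi> \<notin> F \<and> cosymp_compl b \<psi> F = span {\<xi>} + F"

definition minimal_cosymp_coisotropic ::
    "('a::real_vector \<Rightarrow> 'a \<Rightarrow> real) \<Rightarrow> ('a \<Rightarrow> real) \<Rightarrow> 'a set \<Rightarrow> bool" where
  "minimal_cosymp_coisotropic b \<psi> W \<longleftrightarrow>
     cosymp_coisotropic b \<psi> W \<and>
     (\<forall>W'. cosymp_coisotropic b \<psi> W' \<and> W' \<subseteq> W \<longrightarrow> W' = W)"

end

theory Submission
  imports Defs
begin

text \<open>Put \<open>H = ker \<psi>\<close>; a cosymplectically isotropic subspace lies in \<open>H\<close>, where \<open>b\<close> is symplectic, and for
  \<open>F \<subseteq> H\<close> everything reduces to the \<open>b\<close>-orthogonal of \<open>F\<close> in \<open>H\<close>.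

  (1) If \<open>F + \<langle>\<xi>\<rangle>\<close> is coisotropic and \<open>b y w \<noteq> 0\<close> for some \<open>y, w \<in> F\<close>, then the hyperplane
  \<open>{u \<in> F. b u y = 0}\<close> of \<open>F\<close> still gives a coisotropic subspace, so \<open>F + \<langle>\<xi>\<rangle>\<close> is not minimal.
  Conversely, if \<open>F\<close> is Lagrangian-like and \<open>W' \<subseteq> F + \<langle>\<xi>\<rangle>\<close> is coisotropic, taking complements gives
  \<open>F \<subseteq> W'\<close>, and \<open>W' = F\<close> is excluded because the complement of \<open>F\<close> contains \<open>\<xi>\<close>.

  (2) Take a maximal isotropic \<open>M \<subseteq> H\<close> that meets every \<open>L\<^sub>j\<close> trivially. If its orthogonal
  \<open>M'\<close> in \<open>H\<close> were larger than \<open>M\<close>, then no \<open>M + L\<^sub>j\<close> would contain \<open>M'\<close>; as a real vector space is not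
  a finite union of proper subspaces, some \<open>x \<in> M'\<close> would avoid all of them, and
  \<open>M + \<langle>x\<rangle>\<close> would contradict maximality.\<close>

section \<open>Linear algebra over the reals\<close>

text \<open>Induction on \<open>C\<close>. If the point \<open>x\<close> avoiding the older
  subspaces lies in \<open>S\<close>, the line through \<open>y\<close> in direction
  \<open>x\<close> stays outside \<open>S\<close> and meets each older subspace at most once, so one
  of its infinitely many points avoids them all.\<close>

lemma subspace_not_subset_Union_subspaces:
  fixes U :: "'a::real_vector set"
  assumes "finite C" "subspace U" "\<And>S. S \<in> C \<Longrightarrow> subspace S \<and> \<not> U \<subseteq> S"
  shows "\<not> U \<subseteq> \<Union>C"
  using assms(1,3)
proof (induction C rule: finite_induct)
  case empty
  then show ?case using subspace_0[OF assms(2)] by blast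
next
  case (insert S C)
  obtain x where x: "x \<in> U" "x \<notin> \<Union>C" using insert by blast
  obtain y where y: "y \<in> U" "y \<notin> S" using insert by blast
  show ?case
  proof (cases "x \<in> S")
    case False
    then show ?thesis using x by blast
  next
    case True
    have "finite {t. y + t *\<^sub>R x \<in> T}" if "T \<in> C" for T
    proof -
      have T: "subspace T" "x \<notin> T" using that insert.prems x by auto
      have "s = t" if "y + s *\<^sub>R x \<in> T" "y + t *\<^sub>R x \<in> T" for s t
      proof (rule ccontr)
        assume "s \<noteq> t"
        have "(s - t) *\<^sub>R x \<in> T"
          using subspace_diff[OF T(1) that] by (simp add: algebra_simps)
        then have "(1 / (s - t)) *\<^sub>R (s - t) *\<^sub>R x \<in> T" using subspace_scale[OF T(1)] by blast
        then show False using \<open>s \<noteq> t\<close> T(2) by simp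
      qed
      then have "{t. y + t *\<^sub>R x \<in> T} = {} \<or> (\<exists>s. {t. y + t *\<^sub>R x \<in> T} = {s})" by blast
      then show ?thesis by auto
    qed
    then have "finite (\<Union>T\<in>C. {t. y + t *\<^sub>R x \<in> T})" using insert.hyps(1) by blast
    then obtain t where "t \<notin> (\<Union>T\<in>C. {t. y + t *\<^sub>R x \<in> T})"
      using ex_new_if_finite[OF infinite_UNIV_char_0[where 'a=real]] by blast
    then have "y + t *\<^sub>R x \<notin> \<Union>C" by blast
    moreover have "y + t *\<^sub>R x \<notin> S"
    proof
      assume "y + t *\<^sub>R x \<in> S"
      moreover have "t *\<^sub>R x \<in> S" using insert.prems True subspace_scale by blast
      ultimately have "y + t *\<^sub>R x - t *\<^sub>R x \<in> S" using insert.prems subspace_diff by blast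
      then show False using y(2) by simp
    qed
    moreover have "y + t *\<^sub>R x \<in> U" using x y assms(2) by (simp add: subspace_add subspace_scale)
    ultimately show ?thesis by blast
  qed
qed

lemma subspace_set_plus:
  fixes A B :: "'a::real_vector set"
  assumes "subspace A" "subspace B"
  shows "subspace (A + B)"
proof -
  have "A + B = {x + y |x y. x \<in> A \<and> y \<in> B}" by (auto simp: set_plus_def)
  then show ?thesis using subspace_sums[OF assms] by simp
qed

lemma linear_functional_separating_subspace:
  fixes x :: "'a::real_vector"
  assumes "subspace F" "x \<notin> F"
  obtains f :: "'a \<Rightarrow> real" where "linear f" "f x = 1" "\<And>y. y \<in> F \<Longrightarrow> f y = 0"
proof -
  obtain B where B: "B \<subseteq> F" "independent B" "F \<subseteq> span B"
    using maximal_independent_subset by blast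
  have spB: "span B = F" using B assms(1) span_minimal by blast
  then have ind: "independent (insert x B)"
    using independent_insertI B(2) assms(2) by blast
  have "x \<notin> B" using B(1) assms(2) by blast
  obtain f :: "'a \<Rightarrow> real" where f: "linear f" "\<forall>y\<in>insert x B. f y = (if y = x then 1 else 0)"
    using linear_independent_extend[OF ind, of "\<lambda>y. if y = x then 1 else 0"] by blast
  have "f y = 0" if "y \<in> F" for y
  proof (rule linear_eq_0_on_span[OF f(1), of B])
    show "f z = 0" if "z \<in> B" for z using f(2) \<open>x \<notin> B\<close> that by auto
    show "y \<in> span B" using that spB by simp
  qed
  then show thesis using that f by auto
qed

section \<open>Complements and the symplectic orthogonal in the kernel of \<psi>\<close>

context
  fixes b :: "'a::real_vector \<Rightarrow> 'a \<Rightarrow> real" and \<psi> :: "'a \<Rightarrow> real" and \<xi> :: 'a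
  assumes cosym: "cosymplectic b \<psi>" and reeb: "reeb_vector b \<psi> \<xi>"
begin

lemma bil: "bilinear b" and lin: "linear \<psi>" and anti: "b u v = - b v u"
  and fin: "finite_dim TYPE('a)"
  using cosym unfolding cosymplectic_def by blast+

lemmas linear_simps =
  linear_add[OF lin] linear_scale[OF lin] linear_diff[OF lin] linear_0[OF lin]
  bilinear_ladd[OF bil] bilinear_radd[OF bil] bilinear_lmul[OF bil] bilinear_rmul[OF bil]
  bilinear_lsub[OF bil] bilinear_rsub[OF bil] bilinear_lzero[OF bil] bilinear_rzero[OF bil]

lemma reeb_simps [simp]: "\<psi> \<xi> = 1" "b \<xi> u = 0" "b u \<xi> = 0"
  using reeb anti[of u \<xi>] unfolding reeb_vector_def by auto

lemma b_self [simp]: "b u u = 0"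
  using anti[of u u] by simp

lemma in_plus_span_reeb: "x \<in> F + span {\<xi>} \<longleftrightarrow> (\<exists>f\<in>F. \<exists>c. x = f + c *\<^sub>R \<xi>)"
  by (auto simp: set_plus_def span_singleton)

lemma subspace_plus_span_reeb: "subspace F \<Longrightarrow> subspace (F + span {\<xi>})"
  by (rule subspace_set_plus) auto

text \<open>Taking \<open>y = x\<close> kills the antisymmetric term and leaves the square of
  \<open>\<psi> x\<close>, so isotropy splits into two conditions.\<close>

lemma isotropic_imp:
  assumes "cosymp_isotropic b \<psi> F" "x \<in> F"
  shows "\<psi> x = 0" "y \<in> F \<Longrightarrow> b x y = 0"
proof -
  have g: "b x y + \<psi> x * \<psi> y = 0" if "y \<in> F" for y
    using that assms unfolding cosymp_isotropic_def cosymp_map_def by auto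
  show 1: "\<psi> x = 0" using g[OF assms(2)] by simp
  show "y \<in> F \<Longrightarrow> b x y = 0" using g[of y] 1 by simp
qed

lemma cosymp_map_eq_0_imp: "(\<And>u. cosymp_map b \<psi> x u = 0) \<Longrightarrow> x = 0"
proof -
  assume "\<And>u. cosymp_map b \<psi> x u = 0"
  then have "cosymp_map b \<psi> x = cosymp_map b \<psi> 0"
    by (auto simp: cosymp_map_def linear_simps)
  moreover have "inj (cosymp_map b \<psi>)" using cosym by (auto simp: cosymplectic_def bij_betw_def)
  ultimately show ?thesis by (meson injD)
qed

text \<open>For \<open>F\<close> inside the kernel of \<psi> this is its symplectic orthogonal
  there; \<open>\<psi> x = 0\<close> is built in so that Lagrangian-like subspaces become fixed
  points.\<close>

definition horiz_orth :: "'a set \<Rightarrow> 'a set" where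
  "horiz_orth F = {x. \<psi> x = 0 \<and> (\<forall>y\<in>F. b x y = 0)}"

lemma subspace_horiz_orth: "subspace (horiz_orth F)"
  by (auto simp: subspace_def horiz_orth_def linear_simps)

lemma cosymp_compl_plus_span_reeb:
  assumes "subspace F" "\<And>v. v \<in> F \<Longrightarrow> \<psi> v = 0"
  shows "cosymp_compl b \<psi> (F + span {\<xi>}) = horiz_orth F"
proof -
  have "x \<in> horiz_orth F" if x: "x \<in> cosymp_compl b \<psi> (F + span {\<xi>})" for x
  proof -
    have g: "b x f + \<psi> x * (\<psi> f + c) = 0" if "f \<in> F" for f c
    proof -
      have "f + c *\<^sub>R \<xi> \<in> F + span {\<xi>}" using that by (auto simp: in_plus_span_reeb)
      then show ?thesis
        using x by (auto simp: cosymp_compl_def cosymp_map_def linear_simps dest!: bspec[where x="f + c *\<^sub>R \<xi>"])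
    qed
    \<comment> \<open>Testing against \<xi> itself (\<open>f = 0\<close>, \<open>c = 1\<close>)
      forces \<open>x\<close> to be horizontal.\<close>
    have 0: "\<psi> x = 0" using g[OF subspace_0[OF assms(1)], of 1] by (simp add: linear_simps)
    then show ?thesis using g[of _ 0] by (auto simp: horiz_orth_def)
  qed
  moreover have "x \<in> cosymp_compl b \<psi> (F + span {\<xi>})" if "x \<in> horiz_orth F" for x
    using that
    by (auto simp: cosymp_compl_def cosymp_map_def in_plus_span_reeb horiz_orth_def linear_simps)
  ultimately show ?thesis by blast
qed

text \<open>On horizontal \<open>F\<close> the term with \<psi> vanishes, so \<xi> lies in the
  complement and \<open>x\<close> may be shifted along it into the kernel of \<psi>.\<close>

lemma cosymp_compl_eq:
  assumes "\<And>v. v \<in> F \<Longrightarrow> \<psi> v = 0"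
  shows "cosymp_compl b \<psi> F = horiz_orth F + span {\<xi>}"
proof -
  have "x \<in> horiz_orth F + span {\<xi>}" if "x \<in> cosymp_compl b \<psi> F" for x
  proof -
    have "x - \<psi> x *\<^sub>R \<xi> \<in> horiz_orth F"
      using that assms by (auto simp: cosymp_compl_def cosymp_map_def horiz_orth_def linear_simps)
    moreover have "x = (x - \<psi> x *\<^sub>R \<xi>) + \<psi> x *\<^sub>R \<xi>" by simp
    ultimately show ?thesis unfolding in_plus_span_reeb by blast
  qed
  moreover have "x \<in> cosymp_compl b \<psi> F" if "x \<in> horiz_orth F + span {\<xi>}" for x
    using that assms
    by (auto simp: cosymp_compl_def cosymp_map_def in_plus_span_reeb horiz_orth_def linear_simps)
  ultimately show ?thesis by blast
qed

text \<open>\<psi> reads off the coefficient of \<xi>, so \<open>span {\<xi>}\<close> can be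
  cancelled for horizontal sets.\<close>

lemma horizontal_plus_span_reeb_subset:
  assumes "\<And>v. v \<in> F \<Longrightarrow> \<psi> v = 0" "\<And>v. v \<in> G \<Longrightarrow> \<psi> v = 0" "F + span {\<xi>} \<subseteq> G + span {\<xi>}"
  shows "F \<subseteq> G"
proof
  fix x assume x: "x \<in> F"
  then have "x + 0 *\<^sub>R \<xi> \<in> F + span {\<xi>}" unfolding in_plus_span_reeb by blast
  then have "x \<in> G + span {\<xi>}" using assms(3) by auto
  then obtain g c where g: "g \<in> G" "x = g + c *\<^sub>R \<xi>"
    unfolding in_plus_span_reeb by blast
  have "c = 0" using arg_cong[OF g(2), of \<psi>] assms(1)[OF x] assms(2)[OF g(1)] by (simp add: linear_simps)
  then show "x \<in> G" using g by simp
qed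

text \<open>Cancelling \<open>span {\<xi>}\<close> from the two expressions for the complement
  leaves the usual Lagrangian condition in the kernel of \<psi>.\<close>

lemma lagrangian_like_iff:
  assumes "subspace F"
  shows "lagrangian_like b \<psi> \<xi> F \<longleftrightarrow> horiz_orth F = F"
proof
  assume L: "lagrangian_like b \<psi> \<xi> F"
  then have iso: "cosymp_isotropic b \<psi> F" and c: "cosymp_compl b \<psi> F = F + span {\<xi>}"
    by (auto simp: lagrangian_like_def add.commute)
  have 0: "\<And>v. v \<in> F \<Longrightarrow> \<psi> v = 0" using isotropic_imp(1)[OF iso] .
  have e: "horiz_orth F + span {\<xi>} = F + span {\<xi>}" using cosymp_compl_eq[OF 0] c by simp
  have 1: "\<And>v. v \<in> horiz_orth F \<Longrightarrow> \<psi> v = 0" by (simp add: horiz_orth_def)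
  show "horiz_orth F = F"
    using horizontal_plus_span_reeb_subset[OF 1 0] horizontal_plus_span_reeb_subset[OF 0 1] e by blast
next
  assume e: "horiz_orth F = F"
  have 0: "\<psi> v = 0" "\<And>w. w \<in> F \<Longrightarrow> b v w = 0" if "v \<in> F" for v
    using that e unfolding horiz_orth_def by blast+
  then have "\<xi> \<notin> F" by force
  moreover have "cosymp_compl b \<psi> F = span {\<xi>} + F"
    using cosymp_compl_eq[of F] 0(1) e by (simp add: add.commute)
  ultimately show "lagrangian_like b \<psi> \<xi> F"
    using assms 0 by (auto simp: lagrangian_like_def cosymp_isotropic_def cosymp_map_def)
qed

text \<open>Bijectivity of \<open>cosymp_map\<close> replaces a dimension count: a functional
  separating \<open>x\<close> from \<open>F\<close> is represented by some \<open>v\<close> in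
  \<open>horiz_orth F\<close>, and \<open>b v x = 1\<close> contradicts the choice of
  \<open>x\<close>.\<close>

lemma horiz_orth_horiz_orth_subset:
  assumes "subspace F" "\<And>v. v \<in> F \<Longrightarrow> \<psi> v = 0"
  shows "horiz_orth (horiz_orth F) \<subseteq> F"
proof (rule subsetI, rule ccontr)
  fix x assume x: "x \<in> horiz_orth (horiz_orth F)" "x \<notin> F"
  \<comment> \<open>The functional must also vanish at \<xi> so that \<open>v\<close> is horizontal;
    hence \<open>x\<close> has to be kept off the larger space.\<close>
  have "x \<notin> F + span {\<xi>}"
  proof
    assume "x \<in> F + span {\<xi>}"
    then obtain f c where f: "f \<in> F" "x = f + c *\<^sub>R \<xi>" unfolding in_plus_span_reeb by blast
    moreover have "\<psi> x = 0" using x by (simp add: horiz_orth_def)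
    ultimately have "c = 0" using assms(2) by (simp add: linear_simps)
    then show False using f x by simp
  qed
  then obtain f :: "'a \<Rightarrow> real" where f: "linear f" "f x = 1" "\<And>y. y \<in> F + span {\<xi>} \<Longrightarrow> f y = 0"
    using linear_functional_separating_subspace[OF subspace_plus_span_reeb[OF assms(1)]] by blast
  obtain v where v: "cosymp_map b \<psi> v = f"
    using cosym f(1) unfolding cosymplectic_def bij_betw_def by (metis image_iff mem_Collect_eq)
  have "v \<in> cosymp_compl b \<psi> (F + span {\<xi>})" using v f(3) by (simp add: cosymp_compl_def)
  then have v': "v \<in> horiz_orth F" using cosymp_compl_plus_span_reeb[OF assms] by simp
  then have "b x v = 0" "\<psi> v = 0" using x by (auto simp: horiz_orth_def)
  then have "cosymp_map b \<psi> v x = 0" using anti[of v x] by (simp add: cosymp_map_def)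
  then show False using v f(2) by simp
qed

section \<open>Minimal coisotropic subspaces\<close>

lemma lagrangian_like_imp_minimal:
  assumes dim: "dim (UNIV :: 'a set) > 1" and F: "subspace F" and L: "lagrangian_like b \<psi> \<xi> F"
  shows "minimal_cosymp_coisotropic b \<psi> (F + span {\<xi>})"
proof -
  have e: "horiz_orth F = F" using L lagrangian_like_iff[OF F] by simp
  then have 0: "\<psi> v = 0" if "v \<in> F" for v using that unfolding horiz_orth_def by blast
  have c: "cosymp_compl b \<psi> (F + span {\<xi>}) = F"
    using cosymp_compl_plus_span_reeb[OF F 0] e by simp
  have sub: "F \<subseteq> F + span {\<xi>}"
    using set_zero_plus2[OF span_zero[of "{\<xi>}"], of F] by (simp add: add.commute)
  \<comment> \<open>If the sum were everything, nondegeneracy would give \<open>F = {0}\<close> and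
    the space would be a line; here the dimension bound enters.\<close>
  have "F + span {\<xi>} \<noteq> UNIV"
  proof
    assume U: "F + span {\<xi>} = UNIV"
    have "F \<subseteq> {0}" using c U cosymp_map_eq_0_imp by (auto simp: cosymp_compl_def)
    then have "F + span {\<xi>} \<subseteq> span {\<xi>}" by (auto simp: set_plus_def)
    then have "UNIV \<subseteq> span {\<xi>}" using U by simp
    then have "dim (UNIV :: 'a set) \<le> card {\<xi>}" by (rule dim_le_card) simp
    then show False using dim by simp
  qed
  then have "cosymp_coisotropic b \<psi> (F + span {\<xi>})"
    using c sub subspace_plus_span_reeb[OF F] by (simp add: cosymp_coisotropic_def)
  moreover have "W = F + span {\<xi>}" if W: "cosymp_coisotropic b \<psi> W" "W \<subseteq> F + span {\<xi>}" for W
  proof -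
    have sW: "subspace W" and cW: "cosymp_compl b \<psi> W \<subseteq> W"
      using W(1) by (auto simp: cosymp_coisotropic_def)
    have "cosymp_compl b \<psi> (F + span {\<xi>}) \<subseteq> cosymp_compl b \<psi> W"
      using W(2) unfolding cosymp_compl_def by blast
    then have FW: "F \<subseteq> W" using c cW by simp
    have "\<not> W \<subseteq> F"
    proof
      assume "W \<subseteq> F"
      then have "W = F" using FW by simp
      then have "\<xi> \<in> F" using cW 0 by (auto simp: cosymp_compl_def cosymp_map_def)
      then show False using 0 by force
    qed
    \<comment> \<open>Outside \<open>F\<close> the coefficient of \<xi> is nonzero, and dividing by
      it brings \<xi> into \<open>W\<close>.\<close>
    then obtain w where w: "w \<in> W" "w \<notin> F" by blast
    then obtain f t where f: "f \<in> F" "w = f + t *\<^sub>R \<xi>"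
      using W(2) in_plus_span_reeb by blast
    then have "t \<noteq> 0" using w by auto
    have "(1 / t) *\<^sub>R (w - f) \<in> W" using w(1) f(1) FW sW by (blast intro: subspace_scale subspace_diff)
    then have "\<xi> \<in> W" using f \<open>t \<noteq> 0\<close> by simp
    then have "F + span {\<xi>} \<subseteq> W"
      using FW sW by (auto simp: in_plus_span_reeb intro!: subspace_add subspace_scale)
    then show ?thesis using W(2) by blast
  qed
  ultimately show ?thesis by (auto simp: minimal_cosymp_coisotropic_def)
qed

text \<open>Passing to the hyperplane cut out by \<open>y\<close> enlarges the orthogonal only by
  the line through \<open>y\<close>, which lies in \<open>F\<close> and is orthogonal to
  itself.\<close>

lemma horiz_orth_hyperplane_subset:
  assumes F: "subspace F" and co: "horiz_orth F \<subseteq> F" and y: "y \<in> F" "\<psi> y = 0"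
    and w: "w \<in> F" "b y w \<noteq> 0"
  shows "horiz_orth {u\<in>F. b u y = 0} \<subseteq> {u\<in>F. b u y = 0}"
proof
  fix z assume z: "z \<in> horiz_orth {u\<in>F. b u y = 0}"
  \<comment> \<open>This coefficient makes \<open>z - ?c *\<^sub>R y\<close> orthogonal to
    \<open>w\<close>, which spans \<open>F\<close> together with the hyperplane.\<close>
  let ?c = "b z w / b y w"
  have "b (z - ?c *\<^sub>R y) u = 0" if u: "u \<in> F" for u
  proof -
    \<comment> \<open>Projection of \<open>u\<close> along \<open>w\<close> onto the
      hyperplane.\<close>
    let ?u = "u - (b y u / b y w) *\<^sub>R w"
    have "?u \<in> F" using u w(1) F by (blast intro: subspace_diff subspace_scale)
    moreover have "b ?u y = 0"
      using w(2) anti[of u y] anti[of w y] by (simp add: linear_simps)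
    ultimately have "b z ?u = 0" using z by (simp add: horiz_orth_def)
    then show ?thesis by (simp add: linear_simps)
  qed
  then have d: "z - ?c *\<^sub>R y \<in> horiz_orth F"
    using z y(2) by (simp add: horiz_orth_def linear_simps)
  then have "z - ?c *\<^sub>R y + ?c *\<^sub>R y \<in> F" using co y F by (blast intro: subspace_add subspace_scale)
  moreover have "b (z - ?c *\<^sub>R y) y = 0" using d y by (simp add: horiz_orth_def)
  ultimately show "z \<in> {u\<in>F. b u y = 0}" by (simp add: linear_simps)
qed

text \<open>Coisotropy of the sum gives \<open>horiz_orth F \<subseteq> F\<close>; minimality gives
  the reverse inclusion.\<close>

lemma minimal_imp_lagrangian_like:
  assumes F: "subspace F" and 0: "\<And>v. v \<in> F \<Longrightarrow> \<psi> v = 0"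
    and min: "minimal_cosymp_coisotropic b \<psi> (F + span {\<xi>})"
  shows "lagrangian_like b \<psi> \<xi> F"
proof -
  have co: "cosymp_coisotropic b \<psi> (F + span {\<xi>})"
    using min by (simp add: minimal_cosymp_coisotropic_def)
  then have "horiz_orth F \<subseteq> F + span {\<xi>}"
    using cosymp_compl_plus_span_reeb[OF F 0] by (simp add: cosymp_coisotropic_def)
  have sub: "horiz_orth F \<subseteq> F"
  proof
    fix x assume x: "x \<in> horiz_orth F"
    then obtain f c where f: "f \<in> F" "x = f + c *\<^sub>R \<xi>"
      using \<open>horiz_orth F \<subseteq> F + span {\<xi>}\<close> in_plus_span_reeb by blast
    have "c = 0" using x f 0 by (simp add: horiz_orth_def linear_simps)
    then show "x \<in> F" using f by simp
  qed
  have "b y w = 0" if yw: "y \<in> F" "w \<in> F" for y w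
  proof (rule ccontr)
    assume nz: "b y w \<noteq> 0"
    let ?G = "{u\<in>F. b u y = 0}"
    have G: "subspace ?G" using F by (auto simp: subspace_def linear_simps)
    have "horiz_orth ?G \<subseteq> ?G" using horiz_orth_hyperplane_subset[OF F sub yw(1) 0[OF yw(1)] yw(2) nz] .
    moreover have "?G \<subseteq> ?G + span {\<xi>}"
      using set_zero_plus2[OF span_zero[of "{\<xi>}"], of ?G] by (simp add: add.commute)
    ultimately have "cosymp_compl b \<psi> (?G + span {\<xi>}) \<subseteq> ?G + span {\<xi>}"
      using cosymp_compl_plus_span_reeb[OF G] 0 by simp
    moreover have GF: "?G + span {\<xi>} \<subseteq> F + span {\<xi>}" by (rule set_plus_mono2) auto
    moreover have "F + span {\<xi>} \<noteq> UNIV" using co by (simp add: cosymp_coisotropic_def)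
    ultimately have "cosymp_coisotropic b \<psi> (?G + span {\<xi>})"
      using subspace_plus_span_reeb[OF G] unfolding cosymp_coisotropic_def by blast
    then have e: "?G + span {\<xi>} = F + span {\<xi>}"
      using min GF unfolding minimal_cosymp_coisotropic_def by blast
    \<comment> \<open>Cancelling \<xi> would make the hyperplane all of \<open>F\<close>, although
      \<open>w\<close> lies outside it.\<close>
    have "F \<subseteq> ?G" by (rule horizontal_plus_span_reeb_subset) (use 0 e in auto)
    then show False using yw nz anti[of w y] by auto
  qed
  then have "F \<subseteq> horiz_orth F" using 0 by (auto simp: horiz_orth_def)
  then show ?thesis using sub lagrangian_like_iff[OF F] by blast
qed

section \<open>Transversal Lagrangian-like subspaces\<close>

text \<open>Otherwise \<open>horiz_orth M \<inter> L\<close> would be orthogonal to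
  \<open>M + L\<close>, hence to \<open>horiz_orth M\<close>, so it would lie in
  \<open>M \<inter> L = {0}\<close>; the modular law would then give
  \<open>horiz_orth M = M\<close>.\<close>

lemma horiz_orth_not_subset_plus:
  assumes M: "subspace M" "M \<subseteq> horiz_orth M" and L: "subspace L" "L \<subseteq> horiz_orth L"
    and int: "M \<inter> L = {0}" and ne: "horiz_orth M \<noteq> M"
  shows "\<not> horiz_orth M \<subseteq> M + L"
proof
  assume sub: "horiz_orth M \<subseteq> M + L"
  have triv: "x = 0" if x: "x \<in> horiz_orth M" "x \<in> L" for x
  proof -
    have "b x u = 0" if uM: "u \<in> horiz_orth M" for u
    proof -
      obtain m l where "m \<in> M" "l \<in> L" "u = m + l" using subsetD[OF sub uM] by (rule set_plus_elim)
      moreover have "b x m = 0" using x(1) \<open>m \<in> M\<close> by (simp add: horiz_orth_def)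
      moreover have "b x l = 0" using x(2) \<open>l \<in> L\<close> L(2) by (auto simp: horiz_orth_def)
      ultimately show ?thesis by (simp add: linear_simps)
    qed
    then have "x \<in> horiz_orth (horiz_orth M)" using x(1) by (simp add: horiz_orth_def)
    then have "x \<in> M" using horiz_orth_horiz_orth_subset[OF M(1)] M(2) by (auto simp: horiz_orth_def)
    then show ?thesis using int x by blast
  qed
  have "u \<in> M" if uM: "u \<in> horiz_orth M" for u
  proof -
    obtain m l where u: "m \<in> M" "l \<in> L" "u = m + l" using subsetD[OF sub uM] by (rule set_plus_elim)
    have "u - m \<in> horiz_orth M" using uM u M(2) subspace_horiz_orth by (blast intro: subspace_diff)
    then have "l = 0" using triv u by simp
    then show ?thesis using u by simp
  qed
  then show False using M(2) ne by blast
qed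

text \<open>The new direction \<open>x\<close> is taken in \<open>horiz_orth M\<close> off every
  \<open>M + L\<close>: orthogonality to \<open>M\<close> and to itself keeps the span isotropic,
  and avoidance keeps it transversal.\<close>

lemma isotropic_extension:
  assumes M: "subspace M" "M \<subseteq> horiz_orth M" and ne: "horiz_orth M \<noteq> M"
    and fC: "finite C" and C: "\<And>L. L \<in> C \<Longrightarrow> subspace L \<and> L \<subseteq> horiz_orth L \<and> M \<inter> L = {0}"
  obtains x where "x \<notin> M" "span (insert x M) \<subseteq> horiz_orth (span (insert x M))"
    "\<And>L. L \<in> C \<Longrightarrow> span (insert x M) \<inter> L = {0}"
proof -
  have sum: "subspace (M + L)" if "L \<in> C" for L
    using subspace_set_plus[OF M(1)] C that by blast
  \<comment> \<open>\<open>M\<close> joins the list so that \<open>x\<close> is new even when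
    \<open>C\<close> is empty.\<close>
  have "\<not> horiz_orth M \<subseteq> \<Union>(insert M ((\<lambda>L. M + L) ` C))"
    using fC M ne C sum horiz_orth_not_subset_plus[OF M _ _ _ ne]
    by (intro subspace_not_subset_Union_subspaces subspace_horiz_orth) auto
  then obtain x where x: "x \<in> horiz_orth M" "x \<notin> M" "\<And>L. L \<in> C \<Longrightarrow> x \<notin> M + L" by blast
  have sp: "\<exists>m\<in>M. \<exists>c. u = m + c *\<^sub>R x" if "u \<in> span (insert x M)" for u
  proof -
    obtain c where "u - c *\<^sub>R x \<in> M"
      using \<open>u \<in> _\<close> span_eq_iff[THEN iffD2, OF M(1)] by (auto simp: span_insert)
    then show ?thesis by (intro bexI[of _ "u - c *\<^sub>R x"] exI[of _ c]) auto
  qed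
  have mm: "\<psi> m = 0" "b x m = 0" "b m x = 0" "\<And>n. n \<in> M \<Longrightarrow> b m n = 0" if "m \<in> M" for m
    using that M(2) x(1) anti[of m x] by (auto simp: horiz_orth_def)
  have "span (insert x M) \<subseteq> horiz_orth (span (insert x M))"
  proof
    fix u assume "u \<in> span (insert x M)"
    then show "u \<in> horiz_orth (span (insert x M))"
      using x(1) by (auto simp: horiz_orth_def linear_simps mm dest!: sp)
  qed
  moreover have "span (insert x M) \<inter> L = {0}" if L: "L \<in> C" for L
  proof -
    have sL: "subspace L" using C[OF L] by simp
    have "u = 0" if u: "u \<in> span (insert x M)" "u \<in> L" for u
    proof -
      obtain m c where m: "m \<in> M" "u = m + c *\<^sub>R x" using sp[OF u(1)] by blast
      have "c = 0"
      proof (rule ccontr)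
        assume "c \<noteq> 0"
        \<comment> \<open>Solving \<open>u = m + c *\<^sub>R x\<close> for \<open>x\<close>.\<close>
        have "(- 1 / c) *\<^sub>R m + (1 / c) *\<^sub>R u \<in> M + L"
          using m(1) u(2) M(1) sL by (intro set_plus_intro subspace_scale)
        then have "x \<in> M + L" using m(2) \<open>c \<noteq> 0\<close> by (simp add: algebra_simps)
        then show False using x(3) L by blast
      qed
      then show ?thesis using m u C[OF L] by auto
    qed
    then show ?thesis using sL by (auto simp: span_zero subspace_0)
  qed
  ultimately show thesis using that x(2) by blast
qed

lemma exists_lagrangian_like_transversal:
  assumes fC: "finite C" and lag: "\<And>L. L \<in> C \<Longrightarrow> lagrangian_like b \<psi> \<xi> L"
  shows "\<exists>M. lagrangian_like b \<psi> \<xi> M \<and> (\<forall>L\<in>C. M \<inter> L = {0})"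
proof -
  have C: "subspace L \<and> L \<subseteq> horiz_orth L" if "L \<in> C" for L
  proof -
    have "subspace L" using lag[OF that] by (auto simp: lagrangian_like_def cosymp_isotropic_def)
    then show ?thesis using lagrangian_like_iff lag[OF that] by simp
  qed
  obtain B :: "'a set" where B: "finite B" "span B = UNIV" using fin unfolding finite_dim_def by blast
  \<comment> \<open>Independent sets stand for the subspaces they span, so that maximality can be
    measured by \<open>card\<close>.\<close>
  define P where "P S \<longleftrightarrow> independent S \<and> span S \<subseteq> horiz_orth (span S) \<and> (\<forall>L\<in>C. span S \<inter> L = {0})"
    for S :: "'a set"
  \<comment> \<open>Finiteness is recorded too, since inserting a new vector must raise the
    cardinality.\<close>
  have bound: "finite S \<and> card S \<le> card B" if "P S" for S
    using that independent_span_bound[OF B(1), of S] B(2) by (simp add: P_def)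
  have "P {}"
    using C by (auto simp: P_def horiz_orth_def linear_simps subspace_0 independent_empty)
  then obtain S where S: "P S" "\<And>T. P T \<Longrightarrow> card T \<le> card S"
    using ex_has_greatest_nat[of P "{}" card "Suc (card B)"] bound by (auto simp: less_Suc_eq_le)
  have "horiz_orth (span S) = span S"
  proof (rule ccontr)
    assume "horiz_orth (span S) \<noteq> span S"
    then obtain x where x: "x \<notin> span S" "span (insert x (span S)) \<subseteq> horiz_orth (span (insert x (span S)))"
      "\<And>L. L \<in> C \<Longrightarrow> span (insert x (span S)) \<inter> L = {0}"
      using isotropic_extension[of "span S" C] S(1) fC C unfolding P_def by auto
    have "span (insert x (span S)) = span (insert x S)" by (simp add: span_insert span_span)
    moreover have "independent (insert x S)"
      using independent_insertI x(1) S(1) unfolding P_def by blast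
    ultimately have "P (insert x S)" using x(2,3) by (simp add: P_def)
    then have "card (insert x S) \<le> card S" by (rule S(2))
    moreover have "x \<notin> S" using x(1) span_base by blast
    ultimately show False using bound[OF S(1)] by simp
  qed
  then have "lagrangian_like b \<psi> \<xi> (span S)" using lagrangian_like_iff[OF subspace_span] by blast
  then show ?thesis using S(1) unfolding P_def by blast
qed

end

text \<open>Horizontality singles out \<open>F\<close> among the complements of \<xi> in one and the
  same sum. In dimension one \<open>F = {0}\<close> is Lagrangian-like, but its sum with
  \<open>span {\<xi>}\<close> is not proper.\<close>

theorem proposition2p12:
  fixes b :: "'a::real_vector \<Rightarrow> 'a \<Rightarrow> real" and \<psi> :: "'a \<Rightarrow> real" and \<xi> :: 'a
  assumes "cosymplectic b \<psi>" and "reeb_vector b \<psi> \<xi>"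
  shows "(dim (UNIV :: 'a set) > 1 \<longrightarrow>
           (\<forall>F. subspace F \<and> F \<inter> span {\<xi>} = {0} \<and> (\<forall>v\<in>F. \<psi> v = 0) \<longrightarrow>
             (minimal_cosymp_coisotropic b \<psi> (F + span {\<xi>}) \<longleftrightarrow> lagrangian_like b \<psi> \<xi> F)))
       \<and> (\<forall>(k::nat) (L :: nat \<Rightarrow> 'a set).
           (\<forall>j\<in>{1..k}. lagrangian_like b \<psi> \<xi> (L j)) \<longrightarrow>
           (\<exists>M. lagrangian_like b \<psi> \<xi> M \<and> (\<forall>j\<in>{1..k}. M \<inter> L j = {0})))"
proof (intro conjI impI allI)
  fix F :: "'a set"
  assume dim: "dim (UNIV :: 'a set) > 1"
    and F: "subspace F \<and> F \<inter> span {\<xi>} = {0} \<and> (\<forall>v\<in>F. \<psi> v = 0)"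
  show "minimal_cosymp_coisotropic b \<psi> (F + span {\<xi>}) \<longleftrightarrow> lagrangian_like b \<psi> \<xi> F"
  proof
    assume "lagrangian_like b \<psi> \<xi> F"
    then show "minimal_cosymp_coisotropic b \<psi> (F + span {\<xi>})"
      using F by (intro lagrangian_like_imp_minimal[OF assms dim]) simp_all
  next
    assume "minimal_cosymp_coisotropic b \<psi> (F + span {\<xi>})"
    then show "lagrangian_like b \<psi> \<xi> F"
      using F by (intro minimal_imp_lagrangian_like[OF assms]) simp_all
  qed
next
  fix k :: nat and L :: "nat \<Rightarrow> 'a set"
  assume "\<forall>j\<in>{1..k}. lagrangian_like b \<psi> \<xi> (L j)"
  then show "\<exists>M. lagrangian_like b \<psi> \<xi> M \<and> (\<forall>j\<in>{1..k}. M \<inter> L j = {0})"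
    using exists_lagrangian_like_transversal[OF assms, of "L ` {1..k}"] by auto
qed

end
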